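(* Let $\mu\in\mathbb{C}$. For all integers $m\ge1$, $n\ge2$, the generalised Laguerre polynomials satisfy the second-order differential-difference equation $$T_{m,n}^{(\mu)}\frac{d^2T_{m,n}^{(\mu)}}{dz^2}-\left(\frac{dT_{m,n}^{(\mu)}}{dz}\right)^2=T_{m+1,n-1}^{(\mu)}\,T_{m-1,n+1}^{(\mu)} .$$
   Context: $L_n^{(\alpha)}(z)=\sum_{i=0}^n \frac{(-1)^i}{i!\,(n-i)!}\Big(\prod_{l=i+1}^{n}(\alpha+l)\Big)z^i$ is the associated Laguerre polynomial ($n\ge0$, any complex $\alpha$). The generalised Laguerre polynomial is $T_{m,n}^{(\mu)}(z)=\det\left[\frac{d^{j+k}}{dz^{j+k}}L_{m+n}^{(\mu+1)}(z)\right]_{j,k=0}^{n-1}$ for integers $m\ge0$, $n\ge1$. *)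

theory Defs
  imports Complex_Main "HOL-Computational_Algebra.Polynomial" "Jordan_Normal_Form.Determinant"
begin

definition laguerre :: "nat \<Rightarrow> complex \<Rightarrow> complex poly" where
  "laguerre n \<alpha> = (\<Sum>i=0..n.
     monom ((- 1) ^ i / (fact i * fact (n - i)) * (\<Prod>l=i+1..n. \<alpha> + of_nat l)) i)"

(* Only m >= 0, n >= 1 is meaningful.  The determinant is taken over the ring of polynomials,
   with rows and columns indexed from 0 to n - 1. *)
definition gen_laguerre :: "nat \<Rightarrow> nat \<Rightarrow> complex \<Rightarrow> complex poly" where
  "gen_laguerre m n \<mu> =
     det (mat n n (\<lambda>(j, k). (pderiv ^^ (j + k)) (laguerre (m + n) (\<mu> + 1))))"

end

theory Submission
  imports Defs "Jordan_Normal_Form.Char_Poly"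
begin

text \<open>
  Write \<open>f\<close> for the Laguerre polynomial of degree \<open>m + n\<close>; this degree is the same in all three Hankel
  determinants of the identity.  In the matrix of order \<open>n + 1\<close> whose \<open>(j, k)\<close> entry is the
  derivative of \<open>f\<close> of order \<open>j + k\<close>, the minor omitting the last row and column is \<open>T m n\<close>.
  Differentiating row by row, every row but the last turns into a copy of its successor, so the
  derivative of the minor moves its last row down by one; differentiating once more by columns
  moves its last column.  The identity is therefore the Desnanot--Jacobi identity for this matrix.
\<close>

lemma det_2x2:
  fixes A :: "'a :: comm_ring_1 mat"
  assumes A: "A \<in> carrier_mat 2 2"
  shows "det A = A $$ (0,0) * A $$ (1,1) - A $$ (0,1) * A $$ (1,0)"
proof -
  have "det A = (\<Sum>j<2. A $$ (0,j) * cofactor A 0 j)"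
    by (rule laplace_expansion_row[OF A]) simp
  moreover have "det (mat_delete A 0 j) = A $$ (1, if j = 0 then 1 else 0)" for j
    by (subst det_single) (use A in \<open>auto simp: mat_delete_def\<close>)
  ultimately show ?thesis
    by (simp add: numeral_2_eq_2 cofactor_def)
qed

text \<open>The nonvanishing determinant allows one factor \<open>det A\<close> to be cancelled at
  the end; the general case is then reached by specialisation.\<close>

lemma Desnanot_Jacobi_nonzero:
  fixes A :: "'a :: idom mat"
  assumes A: "A \<in> carrier_mat (k + 2) (k + 2)" and nz: "det A \<noteq> 0"
  shows "det A * det (mat k k (\<lambda>(i, j). A $$ (i, j)))
           = det (mat_delete A k k) * det (mat_delete A (k + 1) (k + 1))
             - det (mat_delete A k (k + 1)) * det (mat_delete A (k + 1) k)"
proof -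
  define d where "d = det A"
  define C where "C = adj_mat A"
  define A11 where "A11 = mat k k (\<lambda>(i, j). A $$ (i, j))"
  define A21 where "A21 = mat 2 k (\<lambda>(i, j). A $$ (k + i, j))"
  define X where "X = mat k 2 (\<lambda>(i, j). C $$ (i, k + j))"
  define Y where "Y = mat 2 2 (\<lambda>(i, j). C $$ (k + i, k + j))"
  \<comment> \<open>The identity matrix with its last two columns replaced by those of the adjugate; taking
      determinants in \<open>A * B\<close> gives the claim multiplied by \<open>det A\<close>.\<close>
  define B where "B = four_block_mat (1\<^sub>m k) X (0\<^sub>m 2 k) Y"
  have C: "C \<in> carrier_mat (k + 2) (k + 2)"
    unfolding C_def by (rule adj_mat(1)[OF A])
  have cof: "C $$ (i, j) = (-1) ^ (i + j) * det (mat_delete A j i)"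
    if "i < k + 2" "j < k + 2" for i j
    using that A by (simp add: C_def adj_mat_def cofactor_def add.commute)
  have AC: "A * C = d \<cdot>\<^sub>m 1\<^sub>m (k + 2)"
    unfolding C_def d_def by (rule adj_mat(2)[OF A])
  have Bc: "B \<in> carrier_mat (k + 2) (k + 2)"
    by (auto simp: B_def X_def Y_def)
  have colB: "col B j = (if j < k then unit_vec (k + 2) j else col C j)" if "j < k + 2" for j
    by (rule eq_vecI) (use that C in \<open>auto simp: B_def X_def Y_def unit_vec_def\<close>)
  \<comment> \<open>A unit column of \<open>B\<close> picks out the corresponding column of
    \<open>A\<close>; the last two columns of \<open>B\<close> are columns of \<open>C\<close>, and
    \<open>A * C\<close> is scalar.\<close>
  have AB: "A * B = four_block_mat A11 (0\<^sub>m k 2) A21 (d \<cdot>\<^sub>m 1\<^sub>m 2)" (is "_ = ?R")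
  proof (rule eq_matI)
    fix i j assume "i < dim_row ?R" "j < dim_col ?R"
    then have ij: "i < k + 2" "j < k + 2" by (auto simp: A11_def)
    have *: "(A * B) $$ (i, j) = row A i \<bullet> col B j"
      using ij A Bc by simp
    show "(A * B) $$ (i, j) = ?R $$ (i, j)"
    proof (cases "j < k")
      case True
      then have "(A * B) $$ (i, j) = A $$ (i, j)"
        unfolding * colB[OF ij(2)] using ij A by simp
      then show ?thesis using ij True by (auto simp: A11_def A21_def)
    next
      case False
      then have "(A * B) $$ (i, j) = (A * C) $$ (i, j)"
        unfolding * colB[OF ij(2)] using ij A C by simp
      then show ?thesis using ij False by (auto simp: AC A11_def A21_def)
    qed
  qed (use A in \<open>auto simp: B_def X_def Y_def A11_def A21_def\<close>)
  have "det B = det Y"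
    unfolding B_def
    by (subst det_four_block_mat_lower_left_zero[of _ k _ 2]) (auto simp: X_def Y_def)
  then have "d * det Y = det (A * B)"
    using det_mult[OF A Bc] by (simp add: d_def)
  also have "\<dots> = det A11 * (d * d)"
    unfolding AB
    by (subst det_four_block_mat_upper_right_zero[of _ k _ 2])
      (auto simp: A11_def A21_def power2_eq_square)
  finally have "d * det Y = d * (d * det A11)" by (simp add: ac_simps)
  then have "d * det A11 = det Y" using nz by (simp add: d_def)
  also have "det Y = C $$ (k, k) * C $$ (k + 1, k + 1) - C $$ (k, k + 1) * C $$ (k + 1, k)"
    by (subst det_2x2) (auto simp: Y_def)
  also have "\<dots> = det (mat_delete A k k) * det (mat_delete A (k + 1) (k + 1))
      - det (mat_delete A k (k + 1)) * det (mat_delete A (k + 1) k)"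
    \<comment> \<open>The adjugate transposes indices, which only swaps the two off-diagonal
      factors; both carry the sign \<open>(-1) ^ (2 * k + 1)\<close>, so the signs cancel.\<close>
    by (simp add: cof)
  finally show ?thesis
    by (simp add: d_def A11_def)
qed

theorem Desnanot_Jacobi:
  fixes A :: "'a :: idom mat"
  assumes A: "A \<in> carrier_mat (k + 2) (k + 2)"
  shows "det A * det (mat k k (\<lambda>(i, j). A $$ (i, j)))
           = det (mat_delete A k k) * det (mat_delete A (k + 1) (k + 1))
             - det (mat_delete A k (k + 1)) * det (mat_delete A (k + 1) k)"
proof -
  \<comment> \<open>\<open>M = X I + A\<close> has nonzero determinant over the polynomial ring and specialises to \<open>A\<close>
      at \<open>X = 0\<close>.\<close>
  define M where "M = char_poly_matrix (- A)"
  have M: "M \<in> carrier_mat (k + 2) (k + 2)"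
    using A by (simp add: M_def)
  have "monic (char_poly (- A))"
    using degree_monic_char_poly[of "- A" "k + 2"] A by simp
  then have "det M \<noteq> 0"
    by (auto simp: M_def char_poly_def)
  note DJ = Desnanot_Jacobi_nonzero[OF M this]
  have M0: "poly (M $$ (i, j)) 0 = A $$ (i, j)" if "i < k + 2" "j < k + 2" for i j
    using that A by (simp add: M_def char_poly_matrix_def)
  \<comment> \<open>Evaluation at 0 is a ring homomorphism, hence commutes with
    determinants.\<close>
  have ev: "poly (det N) 0 = det (map_mat (\<lambda>p. poly p 0) N)" for N :: "'a poly mat"
    by (rule comm_ring_hom.hom_det[symmetric]) unfold_locales
  have "map_mat (\<lambda>p. poly p 0) M = A"
    by (rule eq_matI) (use A M M0 in auto)
  moreover have "map_mat (\<lambda>p. poly p 0) (mat_delete M r s) = mat_delete A r s" for r s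
    by (rule eq_matI) (use A M M0 in \<open>auto simp: mat_delete_def\<close>)
  moreover have "map_mat (\<lambda>p. poly p 0) (mat k k (\<lambda>(i, j). M $$ (i, j)))
      = mat k k (\<lambda>(i, j). A $$ (i, j))"
    by (rule eq_matI) (use M0 in auto)
  ultimately show ?thesis
    using arg_cong[OF DJ, of "\<lambda>p. poly p 0"] by (simp only: poly_mult poly_diff ev)
qed

text \<open>The product rule acts on each term of the permutation expansion, whose signs are
  constants; exchanging the two sums collects the terms by differentiated row.\<close>

lemma pderiv_det:
  fixes A :: "'a :: idom poly mat"
  assumes A: "A \<in> carrier_mat n n"
  shows "pderiv (det A)
           = (\<Sum>k<n. det (mat n n (\<lambda>(i, j). if i = k then pderiv (A $$ (i, j)) else A $$ (i, j))))"
proof -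
  let ?P = "{p. p permutes {0..<n}}"
  have sgn: "pderiv (signof p * q) = signof p * pderiv q" for p :: "nat \<Rightarrow> nat" and q :: "'a poly"
    by (simp add: sign_def pderiv_minus)
  have prod: "prod (\<lambda>i. A $$ (i, p i)) ({0..<n} - {k}) * pderiv (A $$ (k, p k))
      = (\<Prod>i = 0..<n. mat n n (\<lambda>(i, j). if i = k then pderiv (A $$ (i, j)) else A $$ (i, j))
          $$ (i, p i))" (is "_ = prod ?f _")
    if p: "p permutes {0..<n}" and k: "k < n" for p k
  proof -
    have pi: "p i < n" if "i < n" for i
      using permutes_in_image[OF p, of i] that by simp
    have "prod ?f {0..<n} = ?f k * prod ?f ({0..<n} - {k})"
      by (rule prod.remove) (use k in auto)
    also have "prod ?f ({0..<n} - {k}) = prod (\<lambda>i. A $$ (i, p i)) ({0..<n} - {k})"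
      by (rule prod.cong) (auto simp: pi)
    finally show ?thesis using k pi by (simp add: mult.commute)
  qed
  have "pderiv (det A) = (\<Sum>p\<in>?P. signof p * (\<Sum>k = 0..<n.
      prod (\<lambda>i. A $$ (i, p i)) ({0..<n} - {k}) * pderiv (A $$ (k, p k))))"
    unfolding det_def'[OF A] by (simp add: pderiv_sum sgn pderiv_prod)
  also have "\<dots> = (\<Sum>p\<in>?P. \<Sum>k<n. signof p * (\<Prod>i = 0..<n.
      mat n n (\<lambda>(i, j). if i = k then pderiv (A $$ (i, j)) else A $$ (i, j)) $$ (i, p i)))"
    unfolding sum_distrib_left atLeast0LessThan[symmetric]
    by (intro sum.cong refl, subst prod) auto
  also have "\<dots> = (\<Sum>k<n. det (mat n n (\<lambda>(i, j).
      if i = k then pderiv (A $$ (i, j)) else A $$ (i, j))))"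
    by (subst sum.swap, intro sum.cong refl, subst det_def') auto
  finally show ?thesis .
qed

text \<open>A two-index family is used because the first differentiation destroys the Hankel form,
  while the transposed version must still apply for the second.\<close>

lemma pderiv_det_rows:
  fixes f :: "nat \<Rightarrow> nat \<Rightarrow> 'a :: idom poly"
  assumes f: "\<And>i j. pderiv (f i j) = f (Suc i) j"
  shows "pderiv (det (mat (Suc k) (Suc k) (\<lambda>(i, j). f i j)))
           = det (mat (Suc k) (Suc k) (\<lambda>(i, j). f (if i < k then i else Suc i) j))"
proof -
  define D where
    "D l = mat (Suc k) (Suc k) (\<lambda>(i, j). if i = l then f (Suc i) j else f i j)" for l
  have "det (D l) = 0" if "l < k" for l
    by (rule det_identical_rows[of _ "Suc k" l "Suc l"])
      (use that in \<open>auto simp: D_def intro!: eq_vecI\<close>)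
  moreover have "D k = mat (Suc k) (Suc k) (\<lambda>(i, j). f (if i < k then i else Suc i) j)"
    by (rule eq_matI) (auto simp: D_def)
  moreover have "pderiv (det (mat (Suc k) (Suc k) (\<lambda>(i, j). f i j))) = (\<Sum>l<Suc k. det (D l))"
    by (subst pderiv_det[of _ "Suc k"])
      (auto simp only: D_def f mat_carrier intro!: sum.cong arg_cong[of _ _ det] cong_mat,
        auto simp: f)
  ultimately show ?thesis by simp
qed

lemma pderiv_det_cols:
  fixes f :: "nat \<Rightarrow> nat \<Rightarrow> 'a :: idom poly"
  assumes f: "\<And>i j. pderiv (f i j) = f i (Suc j)"
  shows "pderiv (det (mat (Suc k) (Suc k) (\<lambda>(i, j). f i j)))
           = det (mat (Suc k) (Suc k) (\<lambda>(i, j). f i (if j < k then j else Suc j)))"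
proof -
  have tr: "det (mat (Suc k) (Suc k) (\<lambda>(i, j). g i j)) = det (mat (Suc k) (Suc k) (\<lambda>(i, j). g j i))"
    for g :: "nat \<Rightarrow> nat \<Rightarrow> 'a poly"
    by (subst det_transpose[symmetric, of _ "Suc k"])
      (auto intro!: arg_cong[of _ _ det] eq_matI)
  show ?thesis
    using pderiv_det_rows[of "\<lambda>i j. f j i" k] f 
    by (simp add: tr[of f] tr[of "\<lambda>i j. f i (if j < k then j else Suc j)"])
qed

text \<open>This is a Toda equation, valid for every polynomial \<open>f\<close>; for
  \<open>k = 0\<close> the empty determinant gives \<open>\<tau> 0 = 1\<close>.\<close>

theorem Hankel_Wronskian_Toda:
  fixes f :: "'a :: idom poly"
  defines "\<tau> \<equiv> \<lambda>n. det (mat n n (\<lambda>(j, k). (pderiv ^^ (j + k)) f))"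
  shows "\<tau> (Suc k) * pderiv (pderiv (\<tau> (Suc k))) - (pderiv (\<tau> (Suc k)))\<^sup>2
           = \<tau> k * \<tau> (Suc (Suc k))"
proof -
  \<comment> \<open>Skipping the index \<open>k\<close> is exactly how \<open>mat_delete\<close>
    reindexes after deleting row or column \<open>k\<close>.\<close>
  let ?r = "\<lambda>i. if i < k then i else Suc i"
  let ?h = "\<lambda>i j. (pderiv ^^ (i + j)) f"
  define A where "A = mat (k + 2) (k + 2) (\<lambda>(i, j). ?h i j)"
  have A: "A \<in> carrier_mat (k + 2) (k + 2)" by (simp add: A_def)
  have "pderiv (\<tau> (Suc k)) = det (mat (Suc k) (Suc k) (\<lambda>(i, j). ?h (?r i) j))"
    unfolding \<tau>_def by (rule pderiv_det_rows) simp
  moreover have "pderiv (det (mat (Suc k) (Suc k) (\<lambda>(i, j). ?h (?r i) j)))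
      = det (mat (Suc k) (Suc k) (\<lambda>(i, j). ?h (?r i) (?r j)))"
    by (rule pderiv_det_cols) simp
  \<comment> \<open>The first derivative is computed a second time, by columns, so that its square
    becomes the product of the two off-diagonal minors.\<close>
  moreover have "pderiv (\<tau> (Suc k)) = det (mat (Suc k) (Suc k) (\<lambda>(i, j). ?h i (?r j)))"
    unfolding \<tau>_def by (rule pderiv_det_cols) simp
  moreover have "mat (Suc k) (Suc k) (\<lambda>(i, j). ?h (?r i) (?r j)) = mat_delete A k k"
    "mat (Suc k) (Suc k) (\<lambda>(i, j). ?h i j) = mat_delete A (k + 1) (k + 1)"
    "mat (Suc k) (Suc k) (\<lambda>(i, j). ?h (?r i) j) = mat_delete A k (k + 1)"
    "mat (Suc k) (Suc k) (\<lambda>(i, j). ?h i (?r j)) = mat_delete A (k + 1) k"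
    by (auto simp: A_def mat_delete_def intro!: eq_matI)
  moreover have "\<tau> k = det (mat k k (\<lambda>(i, j). A $$ (i, j)))"
    unfolding \<tau>_def by (auto simp: A_def intro!: arg_cong[of _ _ det] eq_matI)
  moreover have "\<tau> (Suc (Suc k)) = det A"
    by (simp add: \<tau>_def A_def)
  ultimately show ?thesis
    using Desnanot_Jacobi[OF A] by (simp add: \<tau>_def power2_eq_square mult.commute)
qed

theorem lemma3p10:
  fixes \<mu> :: complex and m n :: nat
  assumes "m \<ge> 1" and "n \<ge> 2"
  shows "gen_laguerre m n \<mu> * pderiv (pderiv (gen_laguerre m n \<mu>))
           - (pderiv (gen_laguerre m n \<mu>))\<^sup>2
         = gen_laguerre (m + 1) (n - 1) \<mu> * gen_laguerre (m - 1) (n + 1) \<mu>"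
proof -
  \<comment> \<open>The bounds keep the truncated subtractions exact, so all three determinants come
    from the same Laguerre polynomial.\<close>
  have "m + 1 + (n - 1) = m + n" "m - 1 + (n + 1) = m + n" "Suc (n - 1) = n"
    using assms by auto
  then show ?thesis
    using Hankel_Wronskian_Toda[of "n - 1" "laguerre (m + n) (\<mu> + 1)"]
    unfolding gen_laguerre_def by simp
qed

end
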